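(* Let $\mathfrak R$, $\mathfrak D^{\mathrm{si}}$, $\mathfrak D^{\mathrm{so}}$ denote the Rips, Dowker sink and Dowker source filtrations, viewed as maps from networks to filtered simplicial complexes, and let $\mathfrak s$ and $\mathfrak t$ be the max-symmetrization and transposition maps on networks. Then: (1) $\mathfrak R\circ\mathfrak s=\mathfrak R$; (2) $\mathfrak D^{\mathrm{so}}\circ\mathfrak t=\mathfrak D^{\mathrm{si}}$; (3) $\mathfrak D^{\mathrm{si}}\circ\mathfrak t=\mathfrak D^{\mathrm{so}}$. Also, there exist networks $(X,\omega_X)$, $(Y,\omega_Y)$ such that $(\mathfrak D^{\mathrm{si}}\circ\mathfrak s)(X)\neq\mathfrak D^{\mathrm{si}}(X)$ and $(\mathfrak D^{\mathrm{so}}\circ\mathfrak s)(Y)\neq\mathfrak D^{\mathrm{so}}(Y)$.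
   Context: A network is a pair $(X,\omega_X)$ where $X$ is a finite set and $\omega_X:X\times X\to\mathbb R$ is any function. $\mathfrak s(X,\omega_X)=(X,\widehat{\omega_X})$ with $\widehat{\omega_X}(x,x')=\max(\omega_X(x,x'),\omega_X(x',x))$. $\mathfrak t(X,\omega_X)=(X,\omega_X^\top)$ with $\omega_X^\top(x,x')=\omega_X(x',x)$. For $\delta\in\mathbb R$: the Rips complex is $\mathfrak R^\delta_X=\{\varnothing\ne\sigma\subseteq X:\max_{x,x'\in\sigma}\omega_X(x,x')\le\delta\}$; the Dowker sink complex $\mathfrak D^{\mathrm{si}}_{\delta,X}$ consists of nonempty $\sigma\subseteq X$ for which there is $x'\in X$ with $\omega_X(x,x')\le\delta$ for all $x\in\sigma$; the Dowker source complex $\mathfrak D^{\mathrm{so}}_{\delta,X}$ consists of nonempty $\sigma\subseteq X$ for which there is $x'\in X$ with $\omega_X(x',x)\le\delta$ for all $x\in\sigma$. The filtrations $\mathfrak R(X)$, $\mathfrak D^{\mathrm{si}}(X)$, $\mathfrak D^{\mathrm{so}}(X)$ are the corresponding families indexed by $\delta\in\mathbb R$ with inclusion maps. *)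

theory Defs
  imports Complex_Main "HOL-Library.FuncSet"
begin

(* The weight function is extensional (equal to undefined off X * X), so that two networks are
   equal exactly when they have the same points and the same weights on X * X. *)
typedef 'a network =
  "{(X :: 'a set, \<omega> :: 'a \<times> 'a \<Rightarrow> real). finite X \<and> \<omega> \<in> X \<times> X \<rightarrow>\<^sub>E UNIV}"
  by (rule exI[of _ "({}, \<lambda>_. undefined)"]) auto

setup_lifting type_definition_network

lift_definition points :: "'a network \<Rightarrow> 'a set" is fst .

lift_definition weight :: "'a network \<Rightarrow> 'a \<times> 'a \<Rightarrow> real" is snd .

lemma finite_points [simp]: "finite (points N)"
  by transfer auto

lift_definition symmetrization :: "'a network \<Rightarrow> 'a network" is
  "\<lambda>(X, \<omega>). (X, restrict (\<lambda>(x, x'). max (\<omega> (x, x')) (\<omega> (x', x))) (X \<times> X))"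
  by auto

lift_definition transposition :: "'a network \<Rightarrow> 'a network" is
  "\<lambda>(X, \<omega>). (X, restrict (\<lambda>(x, x'). \<omega> (x', x)) (X \<times> X))"
  by auto

(* The vertices are those x with {x} in K; in a Rips or Dowker complex this may be a proper subset
   of the points of the network, since the weights on the diagonal are arbitrary. *)
definition simplicial_complex :: "'a set set \<Rightarrow> bool" where
  "simplicial_complex K \<longleftrightarrow>
     (\<forall>\<sigma>\<in>K. finite \<sigma> \<and> \<sigma> \<noteq> {} \<and> (\<forall>\<tau>. \<tau> \<subseteq> \<sigma> \<and> \<tau> \<noteq> {} \<longrightarrow> \<tau> \<in> K))"

(* The connecting maps of a filtration are the inclusions, hence determined by the nested family. *)
typedef 'a filtered_complex =
  "{K :: real \<Rightarrow> 'a set set. (\<forall>\<delta>. simplicial_complex (K \<delta>)) \<and> (\<forall>\<delta> \<delta>'. \<delta> \<le> \<delta>' \<longrightarrow> K \<delta> \<subseteq> K \<delta>')}"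
  by (rule exI[of _ "\<lambda>_. {}"]) (auto simp: simplicial_complex_def)

setup_lifting type_definition_filtered_complex

definition rips_complex :: "real \<Rightarrow> 'a network \<Rightarrow> 'a set set" where
  "rips_complex \<delta> N = {\<sigma>. \<sigma> \<noteq> {} \<and> \<sigma> \<subseteq> points N \<and> Max (weight N ` (\<sigma> \<times> \<sigma>)) \<le> \<delta>}"

definition dowker_sink_complex :: "real \<Rightarrow> 'a network \<Rightarrow> 'a set set" where
  "dowker_sink_complex \<delta> N =
     {\<sigma>. \<sigma> \<noteq> {} \<and> \<sigma> \<subseteq> points N \<and> (\<exists>x'\<in>points N. \<forall>x\<in>\<sigma>. weight N (x, x') \<le> \<delta>)}"

definition dowker_source_complex :: "real \<Rightarrow> 'a network \<Rightarrow> 'a set set" where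
  "dowker_source_complex \<delta> N =
     {\<sigma>. \<sigma> \<noteq> {} \<and> \<sigma> \<subseteq> points N \<and> (\<exists>x'\<in>points N. \<forall>x\<in>\<sigma>. weight N (x', x) \<le> \<delta>)}"

lift_definition rips :: "'a network \<Rightarrow> 'a filtered_complex" is
  "\<lambda>N \<delta>. rips_complex \<delta> N"
proof (intro conjI allI impI)
  fix N :: "'a network" and \<delta> :: real
  have "\<tau> \<in> rips_complex \<delta> N"
    if \<sigma>: "\<sigma> \<in> rips_complex \<delta> N" and \<tau>: "\<tau> \<subseteq> \<sigma>" "\<tau> \<noteq> {}" for \<sigma> \<tau>
  proof -
    have "finite \<sigma>"
      using \<sigma> finite_subset[OF _ finite_points] by (auto simp: rips_complex_def)
    then have "Max (weight N ` (\<tau> \<times> \<tau>)) \<le> Max (weight N ` (\<sigma> \<times> \<sigma>))"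
      using \<tau> by (intro Max_mono) auto
    then show ?thesis using \<sigma> \<tau> by (auto simp: rips_complex_def)
  qed
  moreover have "finite \<sigma> \<and> \<sigma> \<noteq> {}" if "\<sigma> \<in> rips_complex \<delta> N" for \<sigma>
    using that finite_subset[OF _ finite_points] by (auto simp: rips_complex_def)
  ultimately show "simplicial_complex (rips_complex \<delta> N)"
    by (auto simp: simplicial_complex_def)
next
  fix N :: "'a network" and \<delta> \<delta>' :: real
  assume "\<delta> \<le> \<delta>'"
  then show "rips_complex \<delta> N \<subseteq> rips_complex \<delta>' N"
    by (auto simp: rips_complex_def)
qed

lift_definition dowker_sink :: "'a network \<Rightarrow> 'a filtered_complex" is
  "\<lambda>N \<delta>. dowker_sink_complex \<delta> N"
proof (intro conjI allI impI)
  fix N :: "'a network" and \<delta> :: real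
  show "simplicial_complex (dowker_sink_complex \<delta> N)"
    by (auto simp: simplicial_complex_def dowker_sink_complex_def
        intro: finite_subset[OF _ finite_points])
next
  fix N :: "'a network" and \<delta> \<delta>' :: real
  assume "\<delta> \<le> \<delta>'"
  then show "dowker_sink_complex \<delta> N \<subseteq> dowker_sink_complex \<delta>' N"
    by (fastforce simp: dowker_sink_complex_def)
qed

lift_definition dowker_source :: "'a network \<Rightarrow> 'a filtered_complex" is
  "\<lambda>N \<delta>. dowker_source_complex \<delta> N"
proof (intro conjI allI impI)
  fix N :: "'a network" and \<delta> :: real
  show "simplicial_complex (dowker_source_complex \<delta> N)"
    by (auto simp: simplicial_complex_def dowker_source_complex_def
        intro: finite_subset[OF _ finite_points])
next
  fix N :: "'a network" and \<delta> \<delta>' :: real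
  assume "\<delta> \<le> \<delta>'"
  then show "dowker_source_complex \<delta> N \<subseteq> dowker_source_complex \<delta>' N"
    by (fastforce simp: dowker_source_complex_def)
qed

end

theory Submission
  imports Defs
begin

lemma points_symmetrization [simp]: "points (symmetrization N) = points N"
  by transfer auto

lemma points_transposition [simp]: "points (transposition N) = points N"
  by transfer auto

lemma weight_symmetrization:
  assumes "x \<in> points N" "x' \<in> points N"
  shows "weight (symmetrization N) (x, x') = max (weight N (x, x')) (weight N (x', x))"
  using assms by transfer auto

lemma weight_transposition:
  assumes "x \<in> points N" "x' \<in> points N"
  shows "weight (transposition N) (x, x') = weight N (x', x)"
  using assms by transfer auto

text \<open>The maximum of a nonempty finite set is at most \<open>\<delta>\<close> iff each element
  is. The pointwise form lets weights be compared pair by pair, without handling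
  \<open>Max\<close>.\<close>

lemma rips_complex_altdef:
  "rips_complex \<delta> N =
     {\<sigma>. \<sigma> \<noteq> {} \<and> \<sigma> \<subseteq> points N \<and> (\<forall>x\<in>\<sigma>. \<forall>x'\<in>\<sigma>. weight N (x, x') \<le> \<delta>)}"
proof -
  have "Max (weight N ` (\<sigma> \<times> \<sigma>)) \<le> \<delta> \<longleftrightarrow> (\<forall>x\<in>\<sigma>. \<forall>x'\<in>\<sigma>. weight N (x, x') \<le> \<delta>)"
    if "\<sigma> \<noteq> {}" "\<sigma> \<subseteq> points N" for \<sigma>
    using that finite_subset[OF that(2) finite_points] by (subst Max_le_iff) auto
  then show ?thesis
    unfolding rips_complex_def by blast
qed

text \<open>The Rips condition ranges over all ordered pairs, so it already bounds both arguments of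
  the \<open>max\<close> for each pair of points of a simplex.\<close>

lemma rips_symmetrization: "rips (symmetrization N) = rips N"
proof -
  have "rips_complex \<delta> (symmetrization N) = rips_complex \<delta> N" for \<delta>
    unfolding rips_complex_altdef
    \<comment> \<open>\<open>conj_cong\<close> keeps \<open>\<sigma> \<subseteq> points N\<close>
      available as an assumption, which discharges the premises of
      \<open>weight_symmetrization\<close>.\<close>
    by (intro Collect_cong conj_cong refl) (auto simp: weight_symmetrization subset_iff)
  then show ?thesis
    \<comment> \<open>A filtered complex is determined by its family of complexes, so agreement at
      every \<open>\<delta>\<close> suffices.\<close>
    by (simp add: Rep_filtered_complex_inject[symmetric] rips.rep_eq)
qed

text \<open>Reversing every pair turns a common source of a simplex into a common sink.\<close>

lemma dowker_source_transposition: "dowker_source (transposition N) = dowker_sink N"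
proof -
  have "dowker_source_complex \<delta> (transposition N) = dowker_sink_complex \<delta> N" for \<delta>
    unfolding dowker_source_complex_def dowker_sink_complex_def
    by (intro Collect_cong conj_cong refl) (auto simp: weight_transposition subset_iff)
  then show ?thesis
    by (simp add: Rep_filtered_complex_inject[symmetric] dowker_source.rep_eq dowker_sink.rep_eq)
qed

text \<open>On pairs of points the two swaps cancel; on all other pairs both weights are
  \<open>undefined\<close> by extensionality, so the networks are equal outright.\<close>

lemma transposition_transposition [simp]: "transposition (transposition N) = N"
  by transfer (auto simp: restrict_def PiE_def extensional_def fun_eq_iff)

lemma dowker_sink_transposition: "dowker_sink (transposition N) = dowker_source N"
  \<comment> \<open>The source identity is applied to \<open>transposition N\<close>, and the double
    transposition cancels.\<close>
  by (metis dowker_source_transposition transposition_transposition)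

text \<open>Only the ordered pair \<open>(0, 1)\<close> has weight \<open>0\<close>. At \<open>\<delta> = 0\<close> the point \<open>1\<close> is a sink for \<open>0\<close>
  and \<open>0\<close> is a source for \<open>1\<close>, while all symmetrized weights are \<open>1\<close>.\<close>

lift_definition one_way_network :: "nat network" is
  "({0, 1}, restrict (\<lambda>p. if p = (0, 1) then 0 else 1) ({0, 1} \<times> {0, 1}))"
  by auto

lemma points_one_way_network: "points one_way_network = {0, 1}"
  by transfer simp

lemma weight_one_way_network:
  assumes "x \<in> {0, 1}" "x' \<in> {0, 1}"
  shows "weight one_way_network (x, x') = (if (x, x') = (0, 1) then 0 else 1)"
  using assms by transfer auto

lemma weight_symmetrization_one_way_network:
  assumes "x \<in> {0, 1}" "x' \<in> {0, 1}"
  shows "weight (symmetrization one_way_network) (x, x') = 1"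
  using assms by (auto simp: weight_symmetrization points_one_way_network weight_one_way_network)

lemma dowker_sink_symmetrization_neq:
  "dowker_sink (symmetrization one_way_network) \<noteq> dowker_sink one_way_network"
proof -
  have "{0} \<in> dowker_sink_complex 0 one_way_network"
    by (auto simp: dowker_sink_complex_def points_one_way_network weight_one_way_network)
  moreover have "{0} \<notin> dowker_sink_complex 0 (symmetrization one_way_network)"
    by (auto simp: dowker_sink_complex_def points_one_way_network
        weight_symmetrization_one_way_network)
  ultimately show ?thesis
    by (metis dowker_sink.rep_eq)
qed

lemma dowker_source_symmetrization_neq:
  "dowker_source (symmetrization one_way_network) \<noteq> dowker_source one_way_network"
proof -
  have "{1} \<in> dowker_source_complex 0 one_way_network"
    by (auto simp: dowker_source_complex_def points_one_way_network weight_one_way_network)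
  moreover have "{1} \<notin> dowker_source_complex 0 (symmetrization one_way_network)"
    \<comment> \<open>The second argument is fixed to the vertex \<open>1\<close> of the simplex;
      the first stays free to cover every candidate source.\<close>
    using weight_symmetrization_one_way_network[of _ 1]
    by (auto simp: dowker_source_complex_def points_one_way_network)
  ultimately show ?thesis
    by (metis dowker_source.rep_eq)
qed

theorem theorem43:
  shows
    "(rips :: 'a network \<Rightarrow> 'a filtered_complex) \<circ> symmetrization = rips \<and>
     (dowker_source :: 'a network \<Rightarrow> 'a filtered_complex) \<circ> transposition = dowker_sink \<and>
     (dowker_sink :: 'a network \<Rightarrow> 'a filtered_complex) \<circ> transposition = dowker_source \<and>
     (\<exists>(X :: nat network) (Y :: nat network).
        (dowker_sink \<circ> symmetrization) X \<noteq> dowker_sink X \<and>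
        (dowker_source \<circ> symmetrization) Y \<noteq> dowker_source Y)"
  \<comment> \<open>\<open>one_way_network\<close> serves as both \<open>X\<close> and
    \<open>Y\<close>.\<close>
  using dowker_sink_symmetrization_neq dowker_source_symmetrization_neq
  by (auto simp: fun_eq_iff rips_symmetrization dowker_source_transposition
      dowker_sink_transposition)

end
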